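(* Let $L$ be a first-order language with equality. Every profinite $L$-structure is a retract, in the category $\mathbf{L\text{-}mod}$, of an ultraproduct of finite $L$-structures. More precisely: let $\langle I,\le\rangle$ be an (upward) directed poset and let $(M_i,\{f_{ji}: i\le j\})$ be a cofiltered diagram of finite $L$-structures over $I$, i.e. each $M_i$ ($i\in I$) is a finite $L$-structure, each $f_{ji}:M_j\to M_i$ ($i\le j$) is an $L$-homomorphism, $f_{ii}=\mathrm{Id}_{M_i}$, and $f_{ji}\circ f_{kj}=f_{ki}$ whenever $i\le j\le k$. Let $(P,\{\lambda_i:P\to M_i\}_{i\in I})$ be the limit of this diagram in $\mathbf{L\text{-}mod}$. Let $\iota:P\to\prod_{i\in I}M_i$ be the canonical $L$-embedding, $\iota(x)=(\lambda_i(x))_{i\in I}$. Let $\mathcal U$ be a directed ultrafilter in $\langle I,\le\rangle$, and let $\nu_I:\prod_{i\in I}M_i\to\prod_{i\in I}M_i/\mathcal U$ be the quotient map $x\mapsto x/\mathcal U$. Then the composite $L$-homomorphism $$P\xrightarrow{\ \iota\ }\prod_{i\in I}M_i\xrightarrow{\ \nu_I\ }\prod_{i\in I}M_i/\mathcal U$$ is an $L$-section, i.e. there is an $L$-homomorphism $\gamma^{\mathcal U}:\prod_{i\in I}M_i/\mathcal U\to P$ with $\gamma^{\mathcal U}\circ\nu_I\circ\iota=\mathrm{Id}_P$.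
   Context: $L$ is an arbitrary first-order language with equality, with constant symbols, $n$-ary operation symbols and $n$-ary relation symbols ($n\ge1$). $\mathbf{L\text{-}mod}$ is the category of all $L$-structures (the empty structure is allowed) and $L$-homomorphisms (maps preserving constants and operations, and preserving, not necessarily reflecting, relations). Products in $\mathbf{L\text{-}mod}$ have the Cartesian product as underlying set, with all symbols interpreted coordinatewise (a relation holds in the product iff it holds in every coordinate). An object $A$ of a category is a retract of $B$ if there are morphisms $s:A\to B$ and $r:B\to A$ with $r\circ s=\mathrm{Id}_A$; then $s$ is called a section. A poset $\langle I,\le\rangle$ is (upward) directed if $I\neq\emptyset$ and any two elements have a common upper bound; it is downward directed if its opposite is upward directed. For $i\in I$ put $i^{\rightarrow}=\{j\in I: i\le j\}$. A filter $\mathcal F$ in the set $I$ is a directed filter in $\langle I,\le\rangle$ if $i^{\rightarrow}\in\mathcal F$ for all $i\in I$; a directed ultrafilter is an ultrafilter that is a directed filter. An $L$-structure is profinite if it is $L$-isomorphic to the limit in $\mathbf{L\text{-}mod}$ of a diagram of finite $L$-structures over a downward directed poset. For a filter $\mathcal F$ in a non-empty set $I$ and a family $\{M_i\}_{i\in I}$ of $L$-structures with product $M=\prod_{i\in I}M_i$, the reduced product $M/\mathcal F=\prod_{i\in I}M_i/\mathcal F$ has as underlying set the set of classes $x/\mathcal F$ of the equivalence relation on $M$: $x\sim y$ iff $\{i\in I:x(i)=y(i)\}\in\mathcal F$. Constants and operations are those induced from $M$ by the quotient map, and $M/\mathcal F\models R[x_1/\mathcal F,\dots,x_n/\mathcal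 F]$ iff $\{i\in I:M_i\models R[x_1(i),\dots,x_n(i)]\}\in\mathcal F$. If $\mathcal F$ is an ultrafilter, $M/\mathcal F$ is called the ultraproduct of the family. *)

theory Defs
  imports Complex_Main "HOL-Library.FuncSet"
begin

section \<open>Languages, structures and homomorphisms\<close>

text \<open>
  The symbols of a language form subsets of the types \<open>'c\<close>, \<open>'f\<close>, \<open>'r\<close>; since types are
  nonempty, this is what allows a language to lack symbols of some kind.
\<close>

record ('c, 'f, 'r) language =
  const_syms :: "'c set"
  op_syms :: "'f set"
  rel_syms :: "'r set"
  op_arity :: "'f \<Rightarrow> nat"
  rel_arity :: "'r \<Rightarrow> nat"

definition is_language :: "('c, 'f, 'r) language \<Rightarrow> bool" where
  "is_language L \<longleftrightarrow>
     (\<forall>f \<in> op_syms L. 1 \<le> op_arity L f) \<and> (\<forall>R \<in> rel_syms L. 1 \<le> rel_arity L R)"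

definition tuples :: "'a set \<Rightarrow> nat \<Rightarrow> 'a list set" where
  "tuples A n = {xs. length xs = n \<and> set xs \<subseteq> A}"

record ('a, 'c, 'f, 'r) lstruct =
  carrier :: "'a set"
  const_of :: "'c \<Rightarrow> 'a"
  op_of :: "'f \<Rightarrow> 'a list \<Rightarrow> 'a"
  rel_of :: "'r \<Rightarrow> 'a list set"

definition is_structure :: "('c, 'f, 'r) language \<Rightarrow> ('a, 'c, 'f, 'r) lstruct \<Rightarrow> bool" where
  "is_structure L M \<longleftrightarrow>
     (\<forall>c \<in> const_syms L. const_of M c \<in> carrier M) \<and>
     (\<forall>f \<in> op_syms L. \<forall>xs \<in> tuples (carrier M) (op_arity L f). op_of M f xs \<in> carrier M) \<and>
     (\<forall>R \<in> rel_syms L. rel_of M R \<subseteq> tuples (carrier M) (rel_arity L R))"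

text \<open>
  A homomorphism is represented by any function with the right values on the carrier, so
  equality of morphisms is agreement on the carrier.
\<close>

definition lhom ::
  "('c, 'f, 'r) language \<Rightarrow> ('a, 'c, 'f, 'r) lstruct \<Rightarrow> ('b, 'c, 'f, 'r) lstruct \<Rightarrow> ('a \<Rightarrow> 'b) set"
where
  "lhom L M N = {h. h \<in> carrier M \<rightarrow> carrier N \<and>
     (\<forall>c \<in> const_syms L. h (const_of M c) = const_of N c) \<and>
     (\<forall>f \<in> op_syms L. \<forall>xs \<in> tuples (carrier M) (op_arity L f).
        h (op_of M f xs) = op_of N f (map h xs)) \<and>
     (\<forall>R \<in> rel_syms L. \<forall>xs \<in> tuples (carrier M) (rel_arity L R).
        xs \<in> rel_of M R \<longrightarrow> map h xs \<in> rel_of N R)}"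

definition lisomorphic ::
  "('c, 'f, 'r) language \<Rightarrow> ('a, 'c, 'f, 'r) lstruct \<Rightarrow> ('b, 'c, 'f, 'r) lstruct \<Rightarrow> bool"
where
  "lisomorphic L M N \<longleftrightarrow> (\<exists>h \<in> lhom L M N. \<exists>k \<in> lhom L N M.
     (\<forall>x \<in> carrier M. k (h x) = x) \<and> (\<forall>y \<in> carrier N. h (k y) = y))"

definition is_section ::
  "('c, 'f, 'r) language \<Rightarrow> ('a, 'c, 'f, 'r) lstruct \<Rightarrow> ('b, 'c, 'f, 'r) lstruct \<Rightarrow>
   ('a \<Rightarrow> 'b) \<Rightarrow> bool"
where
  "is_section L A B s \<longleftrightarrow> s \<in> lhom L A B \<and> (\<exists>r \<in> lhom L B A. \<forall>x \<in> carrier A. r (s x) = x)"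

definition is_retract ::
  "('c, 'f, 'r) language \<Rightarrow> ('a, 'c, 'f, 'r) lstruct \<Rightarrow> ('b, 'c, 'f, 'r) lstruct \<Rightarrow> bool"
where
  "is_retract L A B \<longleftrightarrow> (\<exists>s. is_section L A B s)"


section \<open>Directed posets, diagrams and limits\<close>

definition directed_on :: "'i set \<Rightarrow> ('i \<times> 'i) set \<Rightarrow> bool" where
  "directed_on I r \<longleftrightarrow> I \<noteq> {} \<and> (\<forall>i \<in> I. \<forall>j \<in> I. \<exists>k \<in> I. (i, k) \<in> r \<and> (j, k) \<in> r)"

abbreviation down_directed_on :: "'i set \<Rightarrow> ('i \<times> 'i) set \<Rightarrow> bool" where
  "down_directed_on J s \<equiv> directed_on J (s\<inverse>)"

text \<open>
  Diagrams are covariant: \<open>(i, j) \<in> s\<close> gives \<open>g i j : M i \<rightarrow> M j\<close>. A cofiltered diagram with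
  maps \<open>f j i : M j \<rightarrow> M i\<close> for \<open>(i, j) \<in> r\<close> is therefore a diagram over the opposite order
  \<open>r\<inverse>\<close>.
\<close>

definition is_diagram ::
  "('c, 'f, 'r) language \<Rightarrow> 'i set \<Rightarrow> ('i \<times> 'i) set \<Rightarrow>
   ('i \<Rightarrow> ('b, 'c, 'f, 'r) lstruct) \<Rightarrow> ('i \<Rightarrow> 'i \<Rightarrow> 'b \<Rightarrow> 'b) \<Rightarrow> bool"
where
  "is_diagram L J s M g \<longleftrightarrow>
     (\<forall>i \<in> J. is_structure L (M i)) \<and>
     (\<forall>i j. (i, j) \<in> s \<longrightarrow> g i j \<in> lhom L (M i) (M j)) \<and>
     (\<forall>i \<in> J. \<forall>x \<in> carrier (M i). g i i x = x) \<and>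
     (\<forall>i j k. (i, j) \<in> s \<longrightarrow> (j, k) \<in> s \<longrightarrow>
        (\<forall>x \<in> carrier (M i). g j k (g i j x) = g i k x))"

definition is_cone ::
  "('c, 'f, 'r) language \<Rightarrow> 'i set \<Rightarrow> ('i \<times> 'i) set \<Rightarrow>
   ('i \<Rightarrow> ('b, 'c, 'f, 'r) lstruct) \<Rightarrow> ('i \<Rightarrow> 'i \<Rightarrow> 'b \<Rightarrow> 'b) \<Rightarrow>
   ('q, 'c, 'f, 'r) lstruct \<Rightarrow> ('i \<Rightarrow> 'q \<Rightarrow> 'b) \<Rightarrow> bool"
where
  "is_cone L J s M g Q \<mu> \<longleftrightarrow>
     is_structure L Q \<and>
     (\<forall>i \<in> J. \<mu> i \<in> lhom L Q (M i)) \<and>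
     (\<forall>i j. (i, j) \<in> s \<longrightarrow> (\<forall>x \<in> carrier Q. g i j (\<mu> i x) = \<mu> j x))"

definition universal_among ::
  "'q itself \<Rightarrow> ('c, 'f, 'r) language \<Rightarrow> 'i set \<Rightarrow> ('i \<times> 'i) set \<Rightarrow>
   ('i \<Rightarrow> ('b, 'c, 'f, 'r) lstruct) \<Rightarrow> ('i \<Rightarrow> 'i \<Rightarrow> 'b \<Rightarrow> 'b) \<Rightarrow>
   ('p, 'c, 'f, 'r) lstruct \<Rightarrow> ('i \<Rightarrow> 'p \<Rightarrow> 'b) \<Rightarrow> bool"
where
  "universal_among _ L J s M g P lam \<longleftrightarrow>
     (\<forall>(Q :: ('q, 'c, 'f, 'r) lstruct) \<mu>. is_cone L J s M g Q \<mu> \<longrightarrow>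
        (\<exists>h \<in> lhom L Q P.
           (\<forall>i \<in> J. \<forall>x \<in> carrier Q. lam i (h x) = \<mu> i x) \<and>
           (\<forall>h' \<in> lhom L Q P. (\<forall>i \<in> J. \<forall>x \<in> carrier Q. lam i (h' x) = \<mu> i x) \<longrightarrow>
              (\<forall>x \<in> carrier Q. h' x = h x))))"

text \<open>
  The universal property of a limit ranges over structures on arbitrary sets, but a definition
  cannot quantify over types. It suffices to test it against structures on the type \<open>'p\<close> of
  the apex itself and on \<open>'i \<Rightarrow> 'b\<close>, where the limit of compatible families lives: the property
  then holds for structures on any type (\<open>is_limit_universal\<close> below), and limits exist
  (\<open>is_limit_threads\<close> below).
\<close>

definition is_limit ::
  "('c, 'f, 'r) language \<Rightarrow> 'i set \<Rightarrow> ('i \<times> 'i) set \<Rightarrow>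
   ('i \<Rightarrow> ('b, 'c, 'f, 'r) lstruct) \<Rightarrow> ('i \<Rightarrow> 'i \<Rightarrow> 'b \<Rightarrow> 'b) \<Rightarrow>
   ('p, 'c, 'f, 'r) lstruct \<Rightarrow> ('i \<Rightarrow> 'p \<Rightarrow> 'b) \<Rightarrow> bool"
where
  "is_limit L J s M g P lam \<longleftrightarrow>
     is_cone L J s M g P lam \<and>
     universal_among TYPE('p) L J s M g P lam \<and>
     universal_among TYPE('i \<Rightarrow> 'b) L J s M g P lam"

text \<open>
  The index set of the diagram lies in \<open>'i\<close> and its structures have their elements in \<open>'b\<close>;
  both types are arbitrary. The limit may be taken on the type \<open>'i \<Rightarrow> 'b\<close>, as every limit is
  isomorphic to the one of compatible families.
\<close>

definition profinite ::
  "'i itself \<Rightarrow> 'b itself \<Rightarrow> ('c, 'f, 'r) language \<Rightarrow> ('p, 'c, 'f, 'r) lstruct \<Rightarrow> bool"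
where
  "profinite _ _ L P \<longleftrightarrow> is_structure L P \<and>
     (\<exists>(J :: 'i set) s (M :: 'i \<Rightarrow> ('b, 'c, 'f, 'r) lstruct) g
        (Q :: ('i \<Rightarrow> 'b, 'c, 'f, 'r) lstruct) \<mu>.
        partial_order_on J s \<and> down_directed_on J s \<and>
        is_diagram L J s M g \<and> (\<forall>i \<in> J. finite (carrier (M i))) \<and>
        is_limit L J s M g Q \<mu> \<and> lisomorphic L P Q)"


section \<open>Filters\<close>

text \<open>
  A filter in the set \<open>I\<close> is an element \<open>F\<close> of the type \<open>'i filter\<close> with
  \<open>F \<le> principal I\<close>; a subset \<open>A\<close> of \<open>I\<close> belongs to it iff \<open>\<forall>\<^sub>F i in F. i \<in> A\<close>. The improper
  filter is \<open>bot\<close>.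
\<close>

definition filter_in :: "'i set \<Rightarrow> 'i filter \<Rightarrow> bool" where
  "filter_in I F \<longleftrightarrow> F \<le> principal I"

definition ultrafilter_in :: "'i set \<Rightarrow> 'i filter \<Rightarrow> bool" where
  "ultrafilter_in I F \<longleftrightarrow> filter_in I F \<and> F \<noteq> bot \<and>
     (\<forall>A \<subseteq> I. (\<forall>\<^sub>F i in F. i \<in> A) \<or> (\<forall>\<^sub>F i in F. i \<in> I - A))"

definition directed_filter :: "'i set \<Rightarrow> ('i \<times> 'i) set \<Rightarrow> 'i filter \<Rightarrow> bool" where
  "directed_filter I r F \<longleftrightarrow> filter_in I F \<and> (\<forall>i \<in> I. \<forall>\<^sub>F j in F. j \<in> {j \<in> I. (i, j) \<in> r})"

definition directed_ultrafilter :: "'i set \<Rightarrow> ('i \<times> 'i) set \<Rightarrow> 'i filter \<Rightarrow> bool" where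
  "directed_ultrafilter I r F \<longleftrightarrow> ultrafilter_in I F \<and> directed_filter I r F"


section \<open>Products and reduced products\<close>

definition product ::
  "('c, 'f, 'r) language \<Rightarrow> 'i set \<Rightarrow> ('i \<Rightarrow> ('b, 'c, 'f, 'r) lstruct) \<Rightarrow>
   ('i \<Rightarrow> 'b, 'c, 'f, 'r) lstruct"
where
  "product L I M = \<lparr>
     carrier = (\<Pi>\<^sub>E i \<in> I. carrier (M i)),
     const_of = (\<lambda>c. \<lambda>i \<in> I. const_of (M i) c),
     op_of = (\<lambda>f xs. \<lambda>i \<in> I. op_of (M i) f (map (\<lambda>x. x i) xs)),
     rel_of = (\<lambda>R. {xs \<in> tuples (\<Pi>\<^sub>E i \<in> I. carrier (M i)) (rel_arity L R).
        \<forall>i \<in> I. map (\<lambda>x. x i) xs \<in> rel_of (M i) R})\<rparr>"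

definition red_eq ::
  "'i set \<Rightarrow> ('i \<Rightarrow> ('b, 'c, 'f, 'r) lstruct) \<Rightarrow> 'i filter \<Rightarrow> (('i \<Rightarrow> 'b) \<times> ('i \<Rightarrow> 'b)) set"
where
  "red_eq I M F = {(x, y). x \<in> (\<Pi>\<^sub>E i \<in> I. carrier (M i)) \<and> y \<in> (\<Pi>\<^sub>E i \<in> I. carrier (M i)) \<and>
     (\<forall>\<^sub>F i in F. i \<in> {i \<in> I. x i = y i})}"

definition quot_map ::
  "'i set \<Rightarrow> ('i \<Rightarrow> ('b, 'c, 'f, 'r) lstruct) \<Rightarrow> 'i filter \<Rightarrow> ('i \<Rightarrow> 'b) \<Rightarrow> ('i \<Rightarrow> 'b) set"
where
  "quot_map I M F x = red_eq I M F `` {x}"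

text \<open>
  The operations are given by the union of the classes obtained from all choices of
  representatives; these classes coincide (\<open>reduced_product_op\<close>).
\<close>

definition reduced_product ::
  "('c, 'f, 'r) language \<Rightarrow> 'i set \<Rightarrow> ('i \<Rightarrow> ('b, 'c, 'f, 'r) lstruct) \<Rightarrow> 'i filter \<Rightarrow>
   (('i \<Rightarrow> 'b) set, 'c, 'f, 'r) lstruct"
where
  "reduced_product L I M F = \<lparr>
     carrier = (\<Pi>\<^sub>E i \<in> I. carrier (M i)) // red_eq I M F,
     const_of = (\<lambda>c. quot_map I M F (const_of (product L I M) c)),
     op_of = (\<lambda>f Xs. \<Union>xs \<in> {xs. list_all2 (\<in>) xs Xs}.
        quot_map I M F (op_of (product L I M) f xs)),
     rel_of = (\<lambda>R. {map (quot_map I M F) xs | xs.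
        xs \<in> tuples (\<Pi>\<^sub>E i \<in> I. carrier (M i)) (rel_arity L R) \<and>
        (\<forall>\<^sub>F i in F. i \<in> {i \<in> I. map (\<lambda>x. x i) xs \<in> rel_of (M i) R})})\<rparr>"


section \<open>Well-definedness of reduced products\<close>

lemma equiv_red_eq:
  assumes "filter_in I F"
  shows "equiv (\<Pi>\<^sub>E i \<in> I. carrier (M i)) (red_eq I M F)"
proof (rule equivI)
  have I: "\<forall>\<^sub>F i in F. i \<in> I"
    using assms by (simp add: filter_in_def le_principal)
  show "red_eq I M F \<subseteq> (\<Pi>\<^sub>E i \<in> I. carrier (M i)) \<times> (\<Pi>\<^sub>E i \<in> I. carrier (M i))"
    by (auto simp: red_eq_def)
  show "refl_on (\<Pi>\<^sub>E i \<in> I. carrier (M i)) (red_eq I M F)"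
    using I by (auto simp: refl_on_def red_eq_def)
  show "sym (red_eq I M F)"
    by (simp add: sym_def red_eq_def eq_commute)
  show "trans (red_eq I M F)"
  proof (rule transI)
    fix x y z assume xyz: "(x, y) \<in> red_eq I M F" "(y, z) \<in> red_eq I M F"
    then have "\<forall>\<^sub>F i in F. i \<in> {i \<in> I. x i = y i}" "\<forall>\<^sub>F i in F. i \<in> {i \<in> I. y i = z i}"
      by (simp_all add: red_eq_def)
    then have "\<forall>\<^sub>F i in F. i \<in> {i \<in> I. x i = z i}" by eventually_elim simp
    then show "(x, z) \<in> red_eq I M F" using xyz by (simp add: red_eq_def)
  qed
qed

lemma quot_map_eq_iff:
  assumes "filter_in I F" "x \<in> (\<Pi>\<^sub>E i \<in> I. carrier (M i))" "y \<in> (\<Pi>\<^sub>E i \<in> I. carrier (M i))"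
  shows "quot_map I M F x = quot_map I M F y \<longleftrightarrow> (\<forall>\<^sub>F i in F. i \<in> {i \<in> I. x i = y i})"
proof -
  have "quot_map I M F x = quot_map I M F y \<longleftrightarrow> (x, y) \<in> red_eq I M F"
    unfolding quot_map_def by (rule eq_equiv_class_iff[OF equiv_red_eq[OF assms(1)] assms(2,3)])
  then show ?thesis using assms by (simp add: red_eq_def)
qed

lemma eventually_map_eq:
  assumes "list_all2 (\<lambda>x y. \<forall>\<^sub>F i in F. i \<in> {i \<in> I. x i = y i}) xs ys" "filter_in I F"
  shows "\<forall>\<^sub>F i in F. i \<in> I \<and> map (\<lambda>x. x i) xs = map (\<lambda>x. x i) ys"
  using assms(1)
proof (induction rule: list_all2_induct)
  case Nil
  show ?case using assms(2) by (simp add: filter_in_def le_principal)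
next
  case (Cons x xs y ys)
  show ?case using Cons(1,3) by eventually_elim simp
qed

lemma quot_map_list_eq:
  assumes "filter_in I F" "xs \<in> tuples (\<Pi>\<^sub>E i \<in> I. carrier (M i)) n"
    "ys \<in> tuples (\<Pi>\<^sub>E i \<in> I. carrier (M i)) n"
    "map (quot_map I M F) xs = map (quot_map I M F) ys"
  shows "\<forall>\<^sub>F i in F. i \<in> I \<and> map (\<lambda>x. x i) xs = map (\<lambda>x. x i) ys"
proof (rule eventually_map_eq[OF _ assms(1)])
  show "list_all2 (\<lambda>x y. \<forall>\<^sub>F i in F. i \<in> {i \<in> I. x i = y i}) xs ys"
    unfolding list_all2_conv_all_nth
  proof (intro conjI allI impI)
    show "length xs = length ys" using assms(2,3) by (simp add: tuples_def)
    fix k assume k: "k < length xs"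
    then have k': "k < length ys" using assms(2,3) by (simp add: tuples_def)
    have "quot_map I M F (xs ! k) = quot_map I M F (ys ! k)"
      using arg_cong[OF assms(4), of "\<lambda>zs. zs ! k"] k k' by simp
    moreover have "xs ! k \<in> (\<Pi>\<^sub>E i \<in> I. carrier (M i))" "ys ! k \<in> (\<Pi>\<^sub>E i \<in> I. carrier (M i))"
      using assms(2,3) k k' nth_mem unfolding tuples_def by blast+
    ultimately show "\<forall>\<^sub>F i in F. i \<in> {i \<in> I. (xs ! k) i = (ys ! k) i}"
      using quot_map_eq_iff[OF assms(1)] by blast
  qed
qed

lemma reduced_product_rel:
  assumes "filter_in I F" "xs \<in> tuples (\<Pi>\<^sub>E i \<in> I. carrier (M i)) (rel_arity L R)"
  shows "map (quot_map I M F) xs \<in> rel_of (reduced_product L I M F) R \<longleftrightarrow>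
    (\<forall>\<^sub>F i in F. i \<in> {i \<in> I. map (\<lambda>x. x i) xs \<in> rel_of (M i) R})" (is "?l \<longleftrightarrow> ?r")
proof
  assume ?l
  then obtain ys where ys: "map (quot_map I M F) xs = map (quot_map I M F) ys"
    "ys \<in> tuples (\<Pi>\<^sub>E i \<in> I. carrier (M i)) (rel_arity L R)"
    "\<forall>\<^sub>F i in F. i \<in> {i \<in> I. map (\<lambda>x. x i) ys \<in> rel_of (M i) R}"
    by (auto simp: reduced_product_def)
  show ?r
    using quot_map_list_eq[OF assms ys(2,1)] ys(3) by eventually_elim simp
qed (use assms in \<open>auto simp: reduced_product_def\<close>)

lemma product_op_closed:
  assumes "\<And>i. i \<in> I \<Longrightarrow> is_structure L (M i)" "f \<in> op_syms L"
    "xs \<in> tuples (\<Pi>\<^sub>E i \<in> I. carrier (M i)) (op_arity L f)"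
  shows "op_of (product L I M) f xs \<in> (\<Pi>\<^sub>E i \<in> I. carrier (M i))"
proof -
  have "map (\<lambda>x. x i) xs \<in> tuples (carrier (M i)) (op_arity L f)" if "i \<in> I" for i
    using assms(3) that by (auto simp: tuples_def PiE_iff)
  then show ?thesis
    using assms(1,2) by (auto simp: product_def is_structure_def)
qed

lemma mem_quot_map:
  assumes "filter_in I F"
  shows "x \<in> (\<Pi>\<^sub>E i \<in> I. carrier (M i)) \<Longrightarrow> x \<in> quot_map I M F x"
    and "y \<in> quot_map I M F x \<Longrightarrow>
      y \<in> (\<Pi>\<^sub>E i \<in> I. carrier (M i)) \<and> quot_map I M F y = quot_map I M F x"
proof -
  note eq = equiv_red_eq[OF assms, of M]
  show "x \<in> (\<Pi>\<^sub>E i \<in> I. carrier (M i)) \<Longrightarrow> x \<in> quot_map I M F x"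
    unfolding quot_map_def by (rule equiv_class_self[OF eq])
  assume "y \<in> quot_map I M F x"
  then have xy: "(x, y) \<in> red_eq I M F" by (simp add: quot_map_def)
  show "y \<in> (\<Pi>\<^sub>E i \<in> I. carrier (M i)) \<and> quot_map I M F y = quot_map I M F x"
    using equiv_class_eq[OF eq xy] xy by (simp add: quot_map_def red_eq_def)
qed

lemma reduced_product_op:
  assumes "filter_in I F" "\<And>i. i \<in> I \<Longrightarrow> is_structure L (M i)" "f \<in> op_syms L"
    "xs \<in> tuples (\<Pi>\<^sub>E i \<in> I. carrier (M i)) (op_arity L f)"
  shows "op_of (reduced_product L I M F) f (map (quot_map I M F) xs) =
    quot_map I M F (op_of (product L I M) f xs)"
proof -
  let ?S = "{ys. list_all2 (\<in>) ys (map (quot_map I M F) xs)}"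
  have xs: "x \<in> (\<Pi>\<^sub>E i \<in> I. carrier (M i))" if "x \<in> set xs" for x
    using that assms(4) by (auto simp: tuples_def)
  have "xs \<in> ?S"
    using mem_quot_map(1)[OF assms(1) xs[OF nth_mem]] by (simp add: list_all2_conv_all_nth)
  moreover have "quot_map I M F (op_of (product L I M) f ys) =
      quot_map I M F (op_of (product L I M) f xs)" if "ys \<in> ?S" for ys
  proof -
    have len: "length ys = length xs"
      using that by (auto dest: list_all2_lengthD)
    have k: "ys ! k \<in> (\<Pi>\<^sub>E i \<in> I. carrier (M i)) \<and>
        quot_map I M F (ys ! k) = quot_map I M F (xs ! k)" if "k < length xs" for k
    proof (rule mem_quot_map(2)[OF assms(1)])
      show "ys ! k \<in> quot_map I M F (xs ! k)"
        using \<open>ys \<in> ?S\<close> that len by (simp add: list_all2_conv_all_nth)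
    qed
    have ys: "ys \<in> tuples (\<Pi>\<^sub>E i \<in> I. carrier (M i)) (op_arity L f)"
      using k len assms(4) unfolding tuples_def subset_code(1) all_set_conv_all_nth by simp
    have "map (quot_map I M F) ys = map (quot_map I M F) xs"
      using k len by (auto intro: nth_equalityI)
    from quot_map_list_eq[OF assms(1) ys assms(4) this]
    have "\<forall>\<^sub>F i in F. i \<in>
        {i \<in> I. op_of (product L I M) f ys i = op_of (product L I M) f xs i}"
      by eventually_elim (simp add: product_def)
    then show ?thesis
      using quot_map_eq_iff[OF assms(1) product_op_closed[OF assms(2,3) ys]
          product_op_closed[OF assms(2,3,4)]] by simp
  qed
  ultimately have "(\<Union>ys \<in> ?S. quot_map I M F (op_of (product L I M) f ys)) =
      quot_map I M F (op_of (product L I M) f xs)"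
    by (intro SUP_eq_const) blast+
  then show ?thesis by (simp add: reduced_product_def)
qed


section \<open>Existence of limits and the universal property over all types\<close>

definition threads ::
  "('c, 'f, 'r) language \<Rightarrow> 'i set \<Rightarrow> ('i \<times> 'i) set \<Rightarrow>
   ('i \<Rightarrow> ('b, 'c, 'f, 'r) lstruct) \<Rightarrow> ('i \<Rightarrow> 'i \<Rightarrow> 'b \<Rightarrow> 'b) \<Rightarrow>
   ('i \<Rightarrow> 'b, 'c, 'f, 'r) lstruct"
where
  "threads L J s M g = (let T = {x \<in> (\<Pi>\<^sub>E i \<in> J. carrier (M i)). \<forall>(i, j) \<in> s. g i j (x i) = x j}
     in product L J M
       \<lparr>carrier := T, rel_of := (\<lambda>R. rel_of (product L J M) R \<inter> tuples T (rel_arity L R))\<rparr>)"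

lemma threads_cone:
  assumes "partial_order_on J s" "is_diagram L J s M g"
  shows "is_cone L J s M g (threads L J s M g) (\<lambda>i x. x i)"
proof -
  let ?T = "threads L J s M g"
  have sJ: "i \<in> J \<and> j \<in> J" if "(i, j) \<in> s" for i j
    using assms(1) that by (auto simp: partial_order_on_def preorder_on_def)
  have str: "is_structure L (M i)" if "i \<in> J" for i
    using assms(2) that by (simp add: is_diagram_def)
  have hom: "g i j \<in> lhom L (M i) (M j)" if "(i, j) \<in> s" for i j
    using assms(2) that by (simp add: is_diagram_def)
  have car: "x \<in> carrier ?T \<longleftrightarrow>
      x \<in> (\<Pi>\<^sub>E i \<in> J. carrier (M i)) \<and> (\<forall>(i, j) \<in> s. g i j (x i) = x j)" for x
    by (simp add: threads_def Let_def)
  have tup: "map (\<lambda>x. x i) xs \<in> tuples (carrier (M i)) n"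
    if "xs \<in> tuples (carrier ?T) n" "i \<in> J" for xs n i
    using that by (fastforce simp: tuples_def car PiE_iff)
  have "const_of ?T c \<in> carrier ?T" if c: "c \<in> const_syms L" for c
  proof -
    have "const_of (M i) c \<in> carrier (M i)" if "i \<in> J" for i
      using str[OF that] c by (simp add: is_structure_def)
    moreover have "g i j (const_of (M i) c) = const_of (M j) c" if "(i, j) \<in> s" for i j
      using hom[OF that] c by (simp add: lhom_def)
    ultimately show ?thesis
      unfolding car by (auto simp: threads_def Let_def product_def sJ)
  qed
  moreover have "op_of ?T f xs \<in> carrier ?T"
    if f: "f \<in> op_syms L" and xs: "xs \<in> tuples (carrier ?T) (op_arity L f)" for f xs
  proof -
    have "op_of (M i) f (map (\<lambda>x. x i) xs) \<in> carrier (M i)" if "i \<in> J" for i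
      using str[OF that] f tup[OF xs that] by (simp add: is_structure_def)
    moreover have "g i j (op_of (M i) f (map (\<lambda>x. x i) xs)) = op_of (M j) f (map (\<lambda>x. x j) xs)"
      if ij: "(i, j) \<in> s" for i j
    proof -
      have "map (g i j) (map (\<lambda>x. x i) xs) = map (\<lambda>x. x j) xs"
        using xs ij by (fastforce simp: tuples_def car)
      then show ?thesis
        using hom[OF ij] f tup[OF xs, of i] sJ[OF ij] by (simp add: lhom_def del: map_map)
    qed
    ultimately show ?thesis
      unfolding car by (auto simp: threads_def Let_def product_def sJ)
  qed
  moreover have "rel_of ?T R \<subseteq> tuples (carrier ?T) (rel_arity L R)" for R
    by (simp add: threads_def Let_def)
  ultimately have "is_structure L ?T" by (simp add: is_structure_def)
  moreover have "(\<lambda>x. x i) \<in> lhom L ?T (M i)" if "i \<in> J" for i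
    using that unfolding lhom_def by (auto simp: threads_def Let_def product_def)
  moreover have "g i j (x i) = x j" if "(i, j) \<in> s" "x \<in> carrier ?T" for i j x
    using that car by auto
  ultimately show ?thesis by (simp add: is_cone_def)
qed

lemma threads_universal:
  fixes M :: "'i \<Rightarrow> ('b, 'c, 'f, 'r) lstruct"
  assumes "partial_order_on J s" "is_diagram L J s M g"
  shows "universal_among TYPE('q) L J s M g (threads L J s M g) (\<lambda>i x. x i)"
  unfolding universal_among_def
proof (intro allI impI)
  fix Q :: "('q, 'c, 'f, 'r) lstruct" and \<mu>
  assume cone: "is_cone L J s M g Q \<mu>"
  let ?T = "threads L J s M g" and ?h = "\<lambda>x. \<lambda>i \<in> J. \<mu> i x"
  have sJ: "i \<in> J \<and> j \<in> J" if "(i, j) \<in> s" for i j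
    using assms(1) that by (auto simp: partial_order_on_def preorder_on_def)
  have Q: "is_structure L Q" and hom: "\<And>i. i \<in> J \<Longrightarrow> \<mu> i \<in> lhom L Q (M i)"
    and comp: "\<And>i j x. (i, j) \<in> s \<Longrightarrow> x \<in> carrier Q \<Longrightarrow> g i j (\<mu> i x) = \<mu> j x"
    using cone by (auto simp: is_cone_def)
  have car: "x \<in> carrier ?T \<longleftrightarrow>
      x \<in> (\<Pi>\<^sub>E i \<in> J. carrier (M i)) \<and> (\<forall>(i, j) \<in> s. g i j (x i) = x j)" for x
    by (simp add: threads_def Let_def)
  have \<mu>c: "\<mu> i x \<in> carrier (M i)" if "i \<in> J" "x \<in> carrier Q" for i x
    using hom[OF that(1)] that(2) by (auto simp: lhom_def)
  have mem: "?h x \<in> carrier ?T" if "x \<in> carrier Q" for x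
    using that \<mu>c comp unfolding car by (auto simp: sJ)
  have "?h \<in> lhom L Q ?T"
    unfolding lhom_def
  proof (intro CollectI conjI ballI impI)
    show "?h \<in> carrier Q \<rightarrow> carrier ?T" using mem by blast
    show "?h (const_of Q c) = const_of ?T c" if "c \<in> const_syms L" for c
      using hom that by (auto simp: threads_def Let_def product_def lhom_def)
    show "?h (op_of Q f xs) = op_of ?T f (map ?h xs)"
      if "f \<in> op_syms L" "xs \<in> tuples (carrier Q) (op_arity L f)" for f xs
      using hom that by (auto simp: threads_def Let_def product_def lhom_def comp_def)
    fix R xs
    assume R: "R \<in> rel_syms L" "xs \<in> tuples (carrier Q) (rel_arity L R)" "xs \<in> rel_of Q R"
    have "map ?h xs \<in> tuples (carrier ?T) (rel_arity L R)"
      using R(2) mem by (auto simp: tuples_def)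
    moreover from this have "map ?h xs \<in> tuples (\<Pi>\<^sub>E i \<in> J. carrier (M i)) (rel_arity L R)"
      unfolding tuples_def using car by blast
    moreover have "map (\<lambda>x. x i) (map ?h xs) \<in> rel_of (M i) R" if "i \<in> J" for i
      using hom[OF that] R that by (simp add: lhom_def comp_def)
    ultimately show "map ?h xs \<in> rel_of ?T R"
      by (simp add: threads_def Let_def product_def)
  qed
  moreover have "h' x = ?h x"
    if "h' \<in> lhom L Q ?T" "\<forall>i \<in> J. \<forall>x \<in> carrier Q. h' x i = \<mu> i x" "x \<in> carrier Q" for h' x
  proof -
    have "h' x \<in> (\<Pi>\<^sub>E i \<in> J. carrier (M i))"
      using that(1,3) car by (auto simp: lhom_def)
    then show ?thesis using that(2,3) by (intro ext) (auto simp: PiE_iff extensional_def)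
  qed
  ultimately show "\<exists>h \<in> lhom L Q ?T. (\<forall>i \<in> J. \<forall>x \<in> carrier Q. h x i = \<mu> i x) \<and>
      (\<forall>h' \<in> lhom L Q ?T. (\<forall>i \<in> J. \<forall>x \<in> carrier Q. h' x i = \<mu> i x) \<longrightarrow>
        (\<forall>x \<in> carrier Q. h' x = h x))"
    by (intro bexI[of _ ?h]) auto
qed

lemma is_limit_threads:
  assumes "partial_order_on J s" "is_diagram L J s M g"
  shows "is_limit L J s M g (threads L J s M g) (\<lambda>i x. x i)"
  using threads_cone[OF assms] threads_universal[OF assms] by (simp add: is_limit_def)

lemma lhom_comp:
  assumes "h \<in> lhom L A B" "k \<in> lhom L B C"
  shows "(\<lambda>x. k (h x)) \<in> lhom L A C"
proof -
  have car: "h x \<in> carrier B" if "x \<in> carrier A" for x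
    using assms(1) that by (auto simp: lhom_def)
  have tup: "map h xs \<in> tuples (carrier B) n" if "xs \<in> tuples (carrier A) n" for xs n
    using that car by (auto simp: tuples_def)
  show ?thesis
    unfolding lhom_def
  proof (intro CollectI conjI ballI impI)
    show "(\<lambda>x. k (h x)) \<in> carrier A \<rightarrow> carrier C"
      using assms(2) car by (auto simp: lhom_def)
    show "k (h (const_of A c)) = const_of C c" if "c \<in> const_syms L" for c
      using assms that by (simp add: lhom_def)
    show "k (h (op_of A f xs)) = op_of C f (map (\<lambda>x. k (h x)) xs)"
      if "f \<in> op_syms L" "xs \<in> tuples (carrier A) (op_arity L f)" for f xs
      using assms that tup[OF that(2)] by (simp add: lhom_def comp_def)
    fix R xs
    assume R: "R \<in> rel_syms L" "xs \<in> tuples (carrier A) (rel_arity L R)" "xs \<in> rel_of A R"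
    have "map h xs \<in> rel_of B R" using assms(1) R by (simp add: lhom_def)
    then have "map k (map h xs) \<in> rel_of C R"
      using assms(2) R(1) tup[OF R(2)] unfolding lhom_def by blast
    then show "map (\<lambda>x. k (h x)) xs \<in> rel_of C R" by (simp add: comp_def)
  qed
qed

lemma lhom_id: "(\<lambda>x. x) \<in> lhom L A A"
  by (simp add: lhom_def)

lemma universal_among_unique:
  fixes Q :: "('q, 'c, 'f, 'r) lstruct"
  assumes "universal_among TYPE('q) L J s M g P lam" "is_cone L J s M g Q \<mu>"
    "h \<in> lhom L Q P" "h' \<in> lhom L Q P"
    "\<forall>i \<in> J. \<forall>x \<in> carrier Q. lam i (h x) = \<mu> i x"
    "\<forall>i \<in> J. \<forall>x \<in> carrier Q. lam i (h' x) = \<mu> i x"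
    "x \<in> carrier Q"
  shows "h x = h' x"
proof -
  obtain k where k: "\<forall>h' \<in> lhom L Q P. (\<forall>i \<in> J. \<forall>x \<in> carrier Q. lam i (h' x) = \<mu> i x) \<longrightarrow>
      (\<forall>x \<in> carrier Q. h' x = k x)"
    using assms(1,2) unfolding universal_among_def by blast
  have "h x = k x" by (rule bspec[OF mp[OF bspec[OF k assms(3)] assms(5)] assms(7)])
  moreover have "h' x = k x" by (rule bspec[OF mp[OF bspec[OF k assms(4)] assms(6)] assms(7)])
  ultimately show ?thesis by simp
qed

lemma is_limit_universal:
  fixes P :: "('p, 'c, 'f, 'r) lstruct" and M :: "'i \<Rightarrow> ('b, 'c, 'f, 'r) lstruct"
  assumes "partial_order_on J s" "is_diagram L J s M g" "is_limit L J s M g P lam"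
  shows "universal_among TYPE('q) L J s M g P lam"
  unfolding universal_among_def
proof (intro allI impI)
  fix Q :: "('q, 'c, 'f, 'r) lstruct" and \<mu>
  assume coneQ: "is_cone L J s M g Q \<mu>"
  let ?T = "threads L J s M g"
  have coneP: "is_cone L J s M g P lam"
    and uP: "universal_among TYPE('p) L J s M g P lam"
    and uT: "universal_among TYPE('i \<Rightarrow> 'b) L J s M g P lam"
    using assms(3) by (auto simp: is_limit_def)
  obtain v where v: "v \<in> lhom L ?T P" "\<forall>i \<in> J. \<forall>x \<in> carrier ?T. lam i (v x) = x i"
    using uT threads_cone[OF assms(1,2)] unfolding universal_among_def by blast
  obtain u where u: "u \<in> lhom L P ?T" "\<forall>i \<in> J. \<forall>x \<in> carrier P. u x i = lam i x"
    using threads_universal[OF assms(1,2), where 'q = 'p] coneP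
    unfolding universal_among_def by blast
  obtain w where w: "w \<in> lhom L Q ?T" "\<forall>i \<in> J. \<forall>x \<in> carrier Q. w x i = \<mu> i x"
    using threads_universal[OF assms(1,2), where 'q = 'q] coneQ
    unfolding universal_among_def by blast
  have uc: "u x \<in> carrier ?T" if "x \<in> carrier P" for x using u(1) that by (auto simp: lhom_def)
  have wc: "w x \<in> carrier ?T" if "x \<in> carrier Q" for x using w(1) that by (auto simp: lhom_def)
  have vu: "v (u x) = x" if "x \<in> carrier P" for x
    by (rule universal_among_unique[OF uP coneP lhom_comp[OF u(1) v(1)] lhom_id _ _ that])
      (use u(2) v(2) uc in simp_all)
  show "\<exists>h \<in> lhom L Q P. (\<forall>i \<in> J. \<forall>x \<in> carrier Q. lam i (h x) = \<mu> i x) \<and>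
      (\<forall>h' \<in> lhom L Q P. (\<forall>i \<in> J. \<forall>x \<in> carrier Q. lam i (h' x) = \<mu> i x) \<longrightarrow>
        (\<forall>x \<in> carrier Q. h' x = h x))"
  proof (intro bexI[of _ "\<lambda>x. v (w x)"] conjI ballI impI)
    show "(\<lambda>x. v (w x)) \<in> lhom L Q P" by (rule lhom_comp[OF w(1) v(1)])
    show "lam i (v (w x)) = \<mu> i x" if "i \<in> J" "x \<in> carrier Q" for i x
      using that v(2) w(2) wc by simp
    fix h' x
    assume h': "h' \<in> lhom L Q P" "\<forall>i \<in> J. \<forall>x \<in> carrier Q. lam i (h' x) = \<mu> i x"
      and x: "x \<in> carrier Q"
    have h'c: "h' y \<in> carrier P" if "y \<in> carrier Q" for y
      using h'(1) that by (auto simp: lhom_def)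
    have "u (h' x) = w x"
      by (rule universal_among_unique[OF threads_universal[OF assms(1,2)] coneQ
            lhom_comp[OF h'(1) u(1)] w(1) _ _ x])
        (use h'(2) u(2) h'c w(2) in simp_all)
    then show "h' x = v (w x)" using vu[OF h'c[OF x]] by simp
  qed
qed

end

theory Submission
  imports Defs
begin

text \<open>
  For \<open>x\<close> in the product and \<open>i \<in> I\<close>, the elements \<open>f j i (x j)\<close> of the finite set \<open>M i\<close>,
  defined for all \<open>j\<close> above \<open>i\<close>, are constant on a set belonging to the directed ultrafilter.
  This constant value depends only on the class of \<open>x\<close>, is compatible with the diagram and with
  operations and relations, and for the family \<open>\<lambda>i. lam i p\<close> it is \<open>lam i p\<close> itself. So the
  ultraproduct is the apex of a cone over the diagram, and the mediating morphism into the limit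
  is the retraction.
\<close>

section \<open>Ultrafilters\<close>

text \<open>A chain is a filter base: the infimum of two members is the smaller of them. So what
  holds eventually in \<open>Inf C\<close> already holds eventually in one member, and
  \<open>False\<close> does so in none. For empty \<open>C\<close> the infimum is
  \<open>top\<close>, which is proper because types are inhabited.\<close>

lemma Inf_chain_filter_not_bot:
  fixes C :: "'a filter set"
  assumes "\<And>F G. F \<in> C \<Longrightarrow> G \<in> C \<Longrightarrow> F \<le> G \<or> G \<le> F" "\<And>F. F \<in> C \<Longrightarrow> F \<noteq> bot"
  shows "Inf C \<noteq> bot"
proof (cases "C = {}")
  case False
  have "eventually (\<lambda>_. False) (Inf C) \<longleftrightarrow> (\<exists>F \<in> C. eventually (\<lambda>_. False) F)"
  proof (rule eventually_Inf_base[OF False])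
    fix F G assume "F \<in> C" "G \<in> C"
    then show "\<exists>x \<in> C. x \<le> inf F G" using assms(1) by (metis inf.absorb1 inf.absorb2 order_refl)
  qed
  then show ?thesis using assms(2) by (auto simp: trivial_limit_def)
qed (simp add: trivial_limit_def)

text \<open>Zorn's lemma for the proper filters below \<open>F\<close>, with finer filters counted
  as larger; a nonempty chain is bounded by its infimum.\<close>

lemma minimal_filter_exists:
  fixes F :: "'a filter"
  assumes "F \<noteq> bot"
  obtains U where "U \<le> F" "U \<noteq> bot" "\<And>G. G \<le> U \<Longrightarrow> G \<noteq> bot \<Longrightarrow> G = U"
proof -
  let ?A = "{G. G \<le> F \<and> G \<noteq> bot}"
  have "\<exists>U \<in> ?A. \<forall>G \<in> ?A. G \<le> U \<longrightarrow> G = U"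
  proof (rule predicate_Zorn)
    show "partial_order_on ?A (relation_of (\<lambda>G H. H \<le> G) ?A)"
      by (rule partial_order_on_relation_ofI) auto
    fix C assume C: "C \<in> Chains (relation_of (\<lambda>G H. H \<le> G) ?A)"
    then have sub: "C \<subseteq> ?A" by (rule Chains_relation_of)
    have ch: "G \<le> H \<or> H \<le> G" if "G \<in> C" "H \<in> C" for G H
      using C that by (auto simp: Chains_def relation_of_def)
    show "\<exists>U \<in> ?A. \<forall>G \<in> C. U \<le> G"
    proof (cases "C = {}")
      case True
      \<comment> \<open>The empty chain is bounded by \<open>F\<close> itself; its infimum
        \<open>top\<close> may lie outside \<open>?A\<close>.\<close>
      then show ?thesis using assms by auto
    next
      case False
      then obtain G where "G \<in> C" by blast
      then have "Inf C \<le> F" using sub by (blast intro: Inf_lower order_trans)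
      moreover have "Inf C \<noteq> bot" using ch sub by (intro Inf_chain_filter_not_bot) auto
      ultimately show ?thesis by (blast intro: Inf_lower)
    qed
  qed
  then obtain U where "U \<in> ?A" "\<forall>G \<in> ?A. G \<le> U \<longrightarrow> G = U" by blast
  then show ?thesis using that by auto
qed

text \<open>A minimal proper filter \<open>U\<close> decides every set \<open>A\<close>: if
  adjoining \<open>A\<close> gives the improper filter, then the complement of \<open>A\<close> is
  in \<open>U\<close>; otherwise minimality makes the enlarged filter equal to \<open>U\<close>, so
  \<open>A\<close> is in \<open>U\<close>.\<close>

lemma ultrafilter_in_exists:
  assumes "filter_in I F" "F \<noteq> bot"
  obtains U where "ultrafilter_in I U" "U \<le> F"
proof -
  obtain U where U: "U \<le> F" "U \<noteq> bot" "\<And>G. G \<le> U \<Longrightarrow> G \<noteq> bot \<Longrightarrow> G = U"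
    using minimal_filter_exists[OF assms(2)] by blast
  have I: "\<forall>\<^sub>F i in U. i \<in> I"
    using assms(1) U(1) by (auto simp: filter_in_def le_principal dest: filter_leD)
  have "(\<forall>\<^sub>F i in U. i \<in> A) \<or> (\<forall>\<^sub>F i in U. i \<in> I - A)" for A
  proof (cases "inf U (principal A) = bot")
    case True
    then have "\<forall>\<^sub>F i in U. i \<notin> A" by (simp add: trivial_limit_def eventually_inf_principal)
    with I have "\<forall>\<^sub>F i in U. i \<in> I - A" by eventually_elim simp
    then show ?thesis ..
  next
    case False
    then have "inf U (principal A) = U" using U(3) by simp
    then show ?thesis by (simp add: le_principal flip: inf.absorb_iff1)
  qed
  then have "ultrafilter_in I U"
    using assms(1) U(1,2) by (auto simp: ultrafilter_in_def filter_in_def)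
  then show ?thesis using that U(1) by blast
qed

text \<open>By directedness and transitivity the sets of elements above a given index form a filter
  base. They are nonempty, so they generate a proper filter, and every ultrafilter refining it is
  directed.\<close>

lemma directed_ultrafilter_exists:
  assumes "partial_order_on I r" "directed_on I r"
  obtains U where "directed_ultrafilter I r U"
proof -
  let ?S = "\<lambda>i. {j \<in> I. (i, j) \<in> r}"
  define F where "F = (INF i \<in> I. principal (?S i))"
  have ne: "I \<noteq> {}" using assms(2) by (simp add: directed_on_def)
  have tr: "trans r" using assms(1) by (simp add: partial_order_on_def preorder_on_def)
  have ev: "eventually P F \<longleftrightarrow> (\<exists>i \<in> I. eventually P (principal (?S i)))" for P
    unfolding F_def
  proof (rule eventually_INF_base[OF ne])
    fix i j assume "i \<in> I" "j \<in> I"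
    then obtain k where "k \<in> I" "(i, k) \<in> r" "(j, k) \<in> r"
      using assms(2) by (auto simp: directed_on_def)
    then show "\<exists>x \<in> I. principal (?S x) \<le> inf (principal (?S i)) (principal (?S j))"
      using tr by (auto intro!: bexI[of _ k] dest: transD)
  qed
  have "\<exists>j. j \<in> ?S i" if "i \<in> I" for i
    using assms(2) that by (auto simp: directed_on_def)
  then have "F \<noteq> bot" by (fastforce simp: trivial_limit_def ev eventually_principal)
  moreover have "filter_in I F"
    using ne by (auto simp: filter_in_def le_principal ev eventually_principal)
  ultimately obtain U where U: "ultrafilter_in I U" "U \<le> F"
    using ultrafilter_in_exists by blast
  have "\<forall>\<^sub>F j in U. j \<in> ?S i" if "i \<in> I" for i
    by (rule filter_leD[OF U(2)]) (use that in \<open>auto simp: ev eventually_principal\<close>)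
  then have "directed_ultrafilter I r U"
    using U(1) by (auto simp: directed_ultrafilter_def directed_filter_def ultrafilter_in_def)
  then show ?thesis using that by blast
qed

text \<open>This is where finiteness enters. If no fibre of \<open>h\<close> over \<open>S\<close>
  were in \<open>U\<close>, all their complements would be, and so would the finite intersection of
  these, on which \<open>h\<close> avoids \<open>S\<close>.\<close>

lemma ultrafilter_in_constant:
  assumes "ultrafilter_in I U" "finite S" "\<forall>\<^sub>F i in U. h i \<in> S"
  obtains y where "y \<in> S" "\<forall>\<^sub>F i in U. h i = y"
proof -
  have I: "\<forall>\<^sub>F i in U. i \<in> I" and nb: "U \<noteq> bot"
    using assms(1) by (auto simp: ultrafilter_in_def filter_in_def le_principal)
  have "\<exists>y \<in> S. \<forall>\<^sub>F i in U. h i = y"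
  proof (rule ccontr)
    assume neg: "\<not> ?thesis"
    have "\<forall>\<^sub>F i in U. h i \<noteq> y" if "y \<in> S" for y
    proof -
      have "\<not> (\<forall>\<^sub>F i in U. i \<in> {i \<in> I. h i = y})"
        using neg that by (auto simp: eventually_conj_iff)
      moreover have "{i \<in> I. h i = y} \<subseteq> I" by blast
      ultimately have "\<forall>\<^sub>F i in U. i \<in> I - {i \<in> I. h i = y}"
        using assms(1) unfolding ultrafilter_in_def by blast
      then show ?thesis by eventually_elim auto
    qed
    then have "\<forall>\<^sub>F i in U. \<forall>y \<in> S. h i \<noteq> y" using assms(2) by (simp add: eventually_ball_finite)
    with assms(3) have "\<forall>\<^sub>F i in U. False" by eventually_elim blast
    then show False using nb by (simp add: trivial_limit_def)
  qed
  then show ?thesis using that by blast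
qed

section \<open>Products and reduced products\<close>

lemma lhom_closed: "h \<in> lhom L A B \<Longrightarrow> x \<in> carrier A \<Longrightarrow> h x \<in> carrier B"
  by (auto simp: lhom_def)

lemma map_tuples: "h \<in> A \<rightarrow> B \<Longrightarrow> xs \<in> tuples A n \<Longrightarrow> map h xs \<in> tuples B n"
  by (auto simp: tuples_def)

text \<open>Lifts a tuple of classes to a tuple of representatives, so that symbols of a reduced
  product can be evaluated coordinatewise.\<close>

lemma tuples_image:
  assumes "Xs \<in> tuples (h ` A) n"
  obtains xs where "xs \<in> tuples A n" "Xs = map h xs"
proof -
  have "\<forall>X \<in> set Xs. \<exists>x. x \<in> A \<and> X = h x" using assms by (auto simp: tuples_def)
  then obtain k where "\<And>X. X \<in> set Xs \<Longrightarrow> k X \<in> A \<and> X = h (k X)" by metis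
  then have "map k Xs \<in> tuples A n" "Xs = map h (map k Xs)"
    using assms by (auto simp: tuples_def map_idI)
  then show ?thesis using that by blast
qed

lemma product_const_closed:
  assumes "\<And>i. i \<in> I \<Longrightarrow> is_structure L (M i)" "c \<in> const_syms L"
  shows "const_of (product L I M) c \<in> (\<Pi>\<^sub>E i \<in> I. carrier (M i))"
  using assms by (auto simp: product_def is_structure_def)

lemma carrier_reduced_product:
  "carrier (reduced_product L I M F) = quot_map I M F ` (\<Pi>\<^sub>E i \<in> I. carrier (M i))"
  by (auto simp: reduced_product_def quotient_def quot_map_def)

lemma reduced_product_structure:
  assumes "filter_in I F" "\<And>i. i \<in> I \<Longrightarrow> is_structure L (M i)"
  shows "is_structure L (reduced_product L I M F)"
  unfolding is_structure_def
proof (intro conjI ballI)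
  show "const_of (reduced_product L I M F) c \<in> carrier (reduced_product L I M F)"
    if "c \<in> const_syms L" for c
    unfolding carrier_reduced_product using product_const_closed[OF assms(2) that, of I]
    by (simp add: reduced_product_def)
  show "op_of (reduced_product L I M F) f Xs \<in> carrier (reduced_product L I M F)"
    if f: "f \<in> op_syms L"
      and Xs: "Xs \<in> tuples (carrier (reduced_product L I M F)) (op_arity L f)" for f Xs
  proof -
    obtain xs where "xs \<in> tuples (\<Pi>\<^sub>E i \<in> I. carrier (M i)) (op_arity L f)"
      "Xs = map (quot_map I M F) xs"
      using Xs unfolding carrier_reduced_product by (rule tuples_image)
    then show ?thesis
      unfolding carrier_reduced_product
      by (simp add: reduced_product_op[OF assms f] product_op_closed[OF assms(2) f])
  qed
  show "rel_of (reduced_product L I M F) R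
      \<subseteq> tuples (carrier (reduced_product L I M F)) (rel_arity L R)" for R
    unfolding carrier_reduced_product
    using map_tuples[OF image_subset_iff_funcset[THEN iffD1, OF subset_refl]]
    by (auto simp: reduced_product_def)
qed

lemma quot_map_lhom:
  assumes "filter_in I F" "\<And>i. i \<in> I \<Longrightarrow> is_structure L (M i)"
  shows "quot_map I M F \<in> lhom L (product L I M) (reduced_product L I M F)"
proof -
  have I: "\<forall>\<^sub>F i in F. i \<in> I" using assms(1) by (simp add: filter_in_def le_principal)
  have car: "carrier (product L I M) = (\<Pi>\<^sub>E i \<in> I. carrier (M i))" by (simp add: product_def)
  show ?thesis
    unfolding lhom_def
  proof (intro CollectI conjI ballI impI)
    show "quot_map I M F \<in> carrier (product L I M) \<rightarrow> carrier (reduced_product L I M F)"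
      by (auto simp: carrier_reduced_product car)
    show "quot_map I M F (const_of (product L I M) c) = const_of (reduced_product L I M F) c" for c
      by (simp add: reduced_product_def)
    show "quot_map I M F (op_of (product L I M) f xs) =
        op_of (reduced_product L I M F) f (map (quot_map I M F) xs)"
      if "f \<in> op_syms L" "xs \<in> tuples (carrier (product L I M)) (op_arity L f)" for f xs
      using reduced_product_op[OF assms that(1)] that(2) by (simp add: car)
    fix R xs assume xs: "xs \<in> tuples (carrier (product L I M)) (rel_arity L R)"
      and "xs \<in> rel_of (product L I M) R"
    then have "\<forall>i \<in> I. map (\<lambda>x. x i) xs \<in> rel_of (M i) R" by (simp add: product_def)
    \<comment> \<open>A relation true in every coordinate holds on all of \<open>I\<close>, which
      belongs to the filter.\<close>
    then have "\<forall>\<^sub>F i in F. i \<in> {i \<in> I. map (\<lambda>x. x i) xs \<in> rel_of (M i) R}"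
      using I by (auto elim: eventually_mono)
    then show "map (quot_map I M F) xs \<in> rel_of (reduced_product L I M F) R"
      using reduced_product_rel[OF assms(1) xs[unfolded car]] by blast
  qed
qed

lemma product_lhom:
  assumes "\<And>i. i \<in> I \<Longrightarrow> lam i \<in> lhom L P (M i)"
  shows "(\<lambda>x. \<lambda>i \<in> I. lam i x) \<in> lhom L P (product L I M)"
proof -
  have car: "(\<lambda>x. \<lambda>i \<in> I. lam i x) \<in> carrier P \<rightarrow> (\<Pi>\<^sub>E i \<in> I. carrier (M i))"
    using assms by (fastforce simp: lhom_def)
  show ?thesis
    unfolding lhom_def
  proof (intro CollectI conjI ballI impI)
    show "(\<lambda>x. \<lambda>i \<in> I. lam i x) \<in> carrier P \<rightarrow> carrier (product L I M)"
      using car by (simp add: product_def)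
    show "(\<lambda>i \<in> I. lam i (const_of P c)) = const_of (product L I M) c"
      if "c \<in> const_syms L" for c
      using assms that by (auto simp: product_def lhom_def)
    show "(\<lambda>i \<in> I. lam i (op_of P f xs)) =
        op_of (product L I M) f (map (\<lambda>x. \<lambda>i \<in> I. lam i x) xs)"
      if "f \<in> op_syms L" "xs \<in> tuples (carrier P) (op_arity L f)" for f xs
      using assms that by (auto simp: product_def lhom_def comp_def)
    fix R xs
    assume R: "R \<in> rel_syms L" "xs \<in> tuples (carrier P) (rel_arity L R)" "xs \<in> rel_of P R"
    have "map (\<lambda>x. x i) (map (\<lambda>x. \<lambda>i \<in> I. lam i x) xs) \<in> rel_of (M i) R" if "i \<in> I" for i
      using assms[OF that] R that by (simp add: lhom_def comp_def)
    then show "map (\<lambda>x. \<lambda>i \<in> I. lam i x) xs \<in> rel_of (product L I M) R"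
      using map_tuples[OF car R(2)] by (simp add: product_def)
  qed
qed

section \<open>The cone over a diagram of finite structures\<close>

text \<open>The ultrafilter is directed for \<open>r\<close>, while the covariant diagram lives over
  \<open>r\<inverse>\<close>: \<open>f j i\<close> maps \<open>M j\<close> to \<open>M i\<close>
  when \<open>(i, j) \<in> r\<close>.\<close>

locale finite_diagram_ultrafilter =
  fixes L :: "('c, 'f, 'r) language" and I :: "'i set" and r
    and M :: "'i \<Rightarrow> ('b, 'c, 'f, 'r) lstruct" and f and U
  assumes partial_order: "partial_order_on I r"
    and diagram: "is_diagram L I (r\<inverse>) M f"
    and finite_carrier: "i \<in> I \<Longrightarrow> finite (carrier (M i))"
    and ultrafilter: "directed_ultrafilter I r U"
begin

lemma rel_in_index: "(i, j) \<in> r \<Longrightarrow> i \<in> I \<and> j \<in> I"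
  using partial_order by (auto simp: partial_order_on_def preorder_on_def)

lemma component_structure: "i \<in> I \<Longrightarrow> is_structure L (M i)"
  using diagram by (simp add: is_diagram_def)

lemma transition_lhom: "(i, j) \<in> r \<Longrightarrow> f j i \<in> lhom L (M j) (M i)"
  using diagram by (simp add: is_diagram_def)

lemma transition_comp:
  "(i, j) \<in> r \<Longrightarrow> (j, k) \<in> r \<Longrightarrow> x \<in> carrier (M k) \<Longrightarrow> f j i (f k j x) = f k i x"
  using diagram by (simp add: is_diagram_def)

lemma not_bot: "U \<noteq> bot"
  using ultrafilter unfolding directed_ultrafilter_def ultrafilter_in_def by blast

lemma filter_in_index: "filter_in I U"
  using ultrafilter by (simp add: directed_ultrafilter_def ultrafilter_in_def)

lemma eventually_above: "i \<in> I \<Longrightarrow> \<forall>\<^sub>F j in U. (i, j) \<in> r"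
  using ultrafilter
  by (simp add: directed_ultrafilter_def directed_filter_def eventually_conj_iff)

text \<open>The limit along \<open>U\<close> of \<open>f j i (x j)\<close> in the discrete set
  \<open>M i\<close>. Quantifying over representatives \<open>x \<in> X\<close> makes it a function
  of the class.\<close>

definition eventual_value :: "'i \<Rightarrow> ('i \<Rightarrow> 'b) set \<Rightarrow> 'b" where
  "eventual_value i X = (THE y. \<exists>x \<in> X. \<forall>\<^sub>F j in U. f j i (x j) = y)"

lemma eventual_value_eq:
  assumes "x \<in> (\<Pi>\<^sub>E i \<in> I. carrier (M i))" "\<forall>\<^sub>F j in U. f j i (x j) = y"
  shows "eventual_value i (quot_map I M U x) = y"
  unfolding eventual_value_def
proof (rule the_equality)
  show "\<exists>x \<in> quot_map I M U x. \<forall>\<^sub>F j in U. f j i (x j) = y"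
    using mem_quot_map(1)[OF filter_in_index assms(1)] assms(2) by blast
  fix y' assume "\<exists>x \<in> quot_map I M U x. \<forall>\<^sub>F j in U. f j i (x j) = y'"
  then obtain x' where "x' \<in> quot_map I M U x" and y': "\<forall>\<^sub>F j in U. f j i (x' j) = y'" by blast
  then have "\<forall>\<^sub>F j in U. j \<in> {j \<in> I. x j = x' j}" by (simp add: quot_map_def red_eq_def)
  \<comment> \<open>Sets of \<open>U\<close> can be intersected: on a common one the representatives
    agree and both constants are attained. Properness of \<open>U\<close> then gives the equality
    outright.\<close>
  with assms(2) y' have "\<forall>\<^sub>F j in U. y' = y" by eventually_elim auto
  then show "y' = y" using not_bot by simp
qed

lemma eventual_value:
  assumes "x \<in> (\<Pi>\<^sub>E i \<in> I. carrier (M i))" "i \<in> I"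
  shows "eventual_value i (quot_map I M U x) \<in> carrier (M i)"
    and "\<forall>\<^sub>F j in U. f j i (x j) = eventual_value i (quot_map I M U x)"
proof -
  \<comment> \<open>Nothing is known about \<open>f j i\<close> for \<open>j\<close> not above
    \<open>i\<close>, but the indices above \<open>i\<close> form a set of \<open>U\<close>.\<close>
  have car: "\<forall>\<^sub>F j in U. f j i (x j) \<in> carrier (M i)"
    using eventually_above[OF assms(2)]
  proof eventually_elim
    case (elim j)
    then show ?case
      using transition_lhom[OF elim] rel_in_index[OF elim] assms(1) by (auto simp: lhom_def PiE_iff)
  qed
  have "ultrafilter_in I U" using ultrafilter by (simp add: directed_ultrafilter_def)
  then obtain y where y: "y \<in> carrier (M i)" "\<forall>\<^sub>F j in U. f j i (x j) = y"
    by (rule ultrafilter_in_constant[OF _ finite_carrier[OF assms(2)] car])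
  with eventual_value_eq[OF assms(1) y(2)]
  show "eventual_value i (quot_map I M U x) \<in> carrier (M i)"
    and "\<forall>\<^sub>F j in U. f j i (x j) = eventual_value i (quot_map I M U x)"
    by simp_all
qed

text \<open>A tuple has finitely many entries, so a single set of \<open>U\<close> serves all of
  them. At each of its indices the eventual values are images under one homomorphism
  \<open>f j i\<close>.\<close>

lemma eventual_value_map:
  assumes "xs \<in> tuples (\<Pi>\<^sub>E i \<in> I. carrier (M i)) n" "i \<in> I"
  shows "\<forall>\<^sub>F j in U. (i, j) \<in> r \<and> j \<in> I \<and>
    map (\<lambda>x. x j) xs \<in> tuples (carrier (M j)) n \<and>
    map (f j i) (map (\<lambda>x. x j) xs) = map (eventual_value i) (map (quot_map I M U) xs)"
proof -
  have xs: "x \<in> (\<Pi>\<^sub>E i \<in> I. carrier (M i))" if "x \<in> set xs" for x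
    using assms(1) that by (auto simp: tuples_def)
  have "\<forall>\<^sub>F j in U. \<forall>x \<in> set xs. f j i (x j) = eventual_value i (quot_map I M U x)"
    using eventual_value(2)[OF xs assms(2)] by (simp add: eventually_ball_finite)
  with eventually_above[OF assms(2)] show ?thesis
  proof eventually_elim
    case (elim j)
    then have "j \<in> I" using rel_in_index by blast
    moreover have "map (\<lambda>x. x j) xs \<in> tuples (carrier (M j)) n"
      using assms(1) xs \<open>j \<in> I\<close> by (fastforce simp: tuples_def PiE_iff)
    ultimately show ?case using elim by simp
  qed
qed

lemma eventual_value_lhom:
  assumes i: "i \<in> I"
  shows "eventual_value i \<in> lhom L (reduced_product L I M U) (M i)"
  unfolding lhom_def
proof (intro CollectI conjI ballI impI)
  let ?q = "quot_map I M U" and ?A = "\<Pi>\<^sub>E i \<in> I. carrier (M i)"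
  show "eventual_value i \<in> carrier (reduced_product L I M U) \<rightarrow> carrier (M i)"
    using eventual_value(1)[OF _ i] by (auto simp: carrier_reduced_product)
  show "eventual_value i (const_of (reduced_product L I M U) c) = const_of (M i) c"
    if c: "c \<in> const_syms L" for c
  proof -
    \<comment> \<open>The representative of the constant's class has the constant of
      \<open>M j\<close> at each \<open>j\<close>, which \<open>f j i\<close> preserves for all
      \<open>j\<close> above \<open>i\<close>.\<close>
    have "\<forall>\<^sub>F j in U. f j i (const_of (product L I M) c j) = const_of (M i) c"
      using eventually_above[OF i]
    proof eventually_elim
      case (elim j)
      then show ?case
        using transition_lhom[OF elim] rel_in_index[OF elim] c by (simp add: product_def lhom_def)
    qed
    then show ?thesis
      using eventual_value_eq[OF product_const_closed[OF component_structure c]]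
      by (simp add: reduced_product_def)
  qed
  show "eventual_value i (op_of (reduced_product L I M U) g Xs) =
      op_of (M i) g (map (eventual_value i) Xs)"
    if g: "g \<in> op_syms L"
      and Xs: "Xs \<in> tuples (carrier (reduced_product L I M U)) (op_arity L g)" for g Xs
  proof -
    obtain xs where xs: "xs \<in> tuples ?A (op_arity L g)" "Xs = map ?q xs"
      using Xs unfolding carrier_reduced_product by (rule tuples_image)
    have "\<forall>\<^sub>F j in U. f j i (op_of (product L I M) g xs j) =
        op_of (M i) g (map (eventual_value i) Xs)"
      using eventual_value_map[OF xs(1) i]
    proof eventually_elim
      case (elim j)
      then have "f j i (op_of (M j) g (map (\<lambda>x. x j) xs)) =
          op_of (M i) g (map (f j i) (map (\<lambda>x. x j) xs))"
        using transition_lhom[of i j] g unfolding lhom_def by blast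
      then show ?case using elim by (simp add: product_def xs(2) del: map_map)
    qed
    then show ?thesis
      using eventual_value_eq[OF product_op_closed[OF component_structure g xs(1)]]
      by (simp add: xs(2) reduced_product_op[OF filter_in_index component_structure g xs(1)] del: map_map)
  qed
  fix R Xs
  assume R: "R \<in> rel_syms L" "Xs \<in> rel_of (reduced_product L I M U) R"
    and "Xs \<in> tuples (carrier (reduced_product L I M U)) (rel_arity L R)"
  then obtain xs where xs: "xs \<in> tuples ?A (rel_arity L R)" "Xs = map ?q xs"
    unfolding carrier_reduced_product by (blast elim: tuples_image)
  have "\<forall>\<^sub>F j in U. j \<in> {j \<in> I. map (\<lambda>x. x j) xs \<in> rel_of (M j) R}"
    using R(2) reduced_product_rel[OF filter_in_index xs(1)] by (simp add: xs(2))
  \<comment> \<open>The relation holds in \<open>M j\<close> for a set of \<open>j\<close> in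
    \<open>U\<close>; wherever this set meets the one on which \<open>f j i\<close> computes the
    eventual values, it is carried over to \<open>M i\<close>.\<close>
  with eventual_value_map[OF xs(1) i]
  have "\<forall>\<^sub>F j in U. map (eventual_value i) Xs \<in> rel_of (M i) R"
  proof eventually_elim
    case (elim j)
    then have "map (f j i) (map (\<lambda>x. x j) xs) \<in> rel_of (M i) R"
      using transition_lhom[of i j] R(1) unfolding lhom_def by blast
    then show ?case using elim by (simp add: xs(2) del: map_map)
  qed
  then show "map (eventual_value i) Xs \<in> rel_of (M i) R" using not_bot by simp
qed

text \<open>For \<open>U\<close>-almost all \<open>k\<close> above \<open>j\<close>, functoriality
  gives \<open>f k i (x k) = f j i (f k j (x k))\<close>, and \<open>f k j (x k)\<close> is the
  eventual value at \<open>j\<close>. So its image under \<open>f j i\<close> is the eventual value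
  at \<open>i\<close>.\<close>

lemma reduced_product_cone: "is_cone L I (r\<inverse>) M f (reduced_product L I M U) eventual_value"
proof -
  have "f j i (eventual_value j X) = eventual_value i X"
    if ij: "(i, j) \<in> r" and X: "X \<in> carrier (reduced_product L I M U)" for i j X
  proof -
    obtain x where x: "x \<in> (\<Pi>\<^sub>E i \<in> I. carrier (M i))" "X = quot_map I M U x"
      using X by (auto simp: carrier_reduced_product)
    have j: "j \<in> I" using rel_in_index ij by blast
    have "\<forall>\<^sub>F k in U. f k i (x k) = f j i (eventual_value j X)"
      using eventual_value(2)[OF x(1) j] eventually_above[OF j]
    proof eventually_elim
      case (elim k)
      have "x k \<in> carrier (M k)" using x(1) rel_in_index[OF elim(2)] by auto
      then show ?case using transition_comp[OF ij elim(2)] elim(1) by (metis x(2))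
    qed
    then show ?thesis using eventual_value_eq[OF x(1)] by (simp add: x(2))
  qed
  then show ?thesis
    using reduced_product_structure[OF filter_in_index component_structure] eventual_value_lhom
    by (auto simp: is_cone_def)
qed

lemma limit_section:
  fixes P :: "('p, 'c, 'f, 'r) lstruct"
  assumes "is_limit L I (r\<inverse>) M f P lam"
  shows "is_section L P (reduced_product L I M U) (quot_map I M U \<circ> (\<lambda>x. \<lambda>i \<in> I. lam i x))"
proof -
  let ?\<iota> = "\<lambda>x. \<lambda>i \<in> I. lam i x" and ?q = "quot_map I M U" and ?N = "reduced_product L I M U"
  have coneP: "is_cone L I (r\<inverse>) M f P lam" and uP: "universal_among TYPE('p) L I (r\<inverse>) M f P lam"
    using assms by (auto simp: is_limit_def)
  have lam: "lam i \<in> lhom L P (M i)" if "i \<in> I" for i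
    using coneP that by (simp add: is_cone_def)
  have \<iota>: "?\<iota> \<in> lhom L P (product L I M)" using lam by (rule product_lhom)
  have \<iota>c: "?\<iota> x \<in> (\<Pi>\<^sub>E i \<in> I. carrier (M i))" if "x \<in> carrier P" for x
    using lhom_closed[OF \<iota> that] by (simp add: product_def)
  have s: "(\<lambda>x. ?q (?\<iota> x)) \<in> lhom L P ?N"
    by (rule lhom_comp[OF \<iota> quot_map_lhom[OF filter_in_index component_structure]])
  \<comment> \<open>By the cone condition on \<open>lam\<close>, \<open>f j i (lam j x)\<close>
    equals \<open>lam i x\<close> for every \<open>j\<close> above \<open>i\<close>.\<close>
  have val: "eventual_value i (?q (?\<iota> x)) = lam i x" if i: "i \<in> I" and x: "x \<in> carrier P" for i x
  proof (rule eventual_value_eq[OF \<iota>c[OF x]])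
    show "\<forall>\<^sub>F j in U. f j i (?\<iota> x j) = lam i x"
      using eventually_above[OF i]
    proof eventually_elim
      case (elim j)
      then show ?case using coneP x rel_in_index[OF elim] by (simp add: is_cone_def)
    qed
  qed
  have po: "partial_order_on I (r\<inverse>)" using partial_order by simp
  \<comment> \<open>The retraction. The ultraproduct lives on a type of sets of families, which is
    not one of the two types tested in \<open>is_limit\<close>; hence the detour through
    \<open>is_limit_universal\<close>.\<close>
  obtain h where h: "h \<in> lhom L ?N P"
    "\<forall>i \<in> I. \<forall>X \<in> carrier ?N. lam i (h X) = eventual_value i X"
    using is_limit_universal[OF po diagram assms] reduced_product_cone
    unfolding universal_among_def by blast
  \<comment> \<open>The composite and the identity both mediate from the limit cone to itself, so
    uniqueness identifies them.\<close>
  have "h (?q (?\<iota> x)) = x" if "x \<in> carrier P" for x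
  proof (rule universal_among_unique[OF uP coneP lhom_comp[OF s h(1)] lhom_id _ _ that])
    show "\<forall>i \<in> I. \<forall>x \<in> carrier P. lam i (h (?q (?\<iota> x))) = lam i x"
      using h(2) val lhom_closed[OF s] by simp
  qed simp
  then show ?thesis using s h(1) by (auto simp: is_section_def comp_def)
qed

end

section \<open>Profinite structures as retracts of ultraproducts\<close>

lemma is_retract_lisomorphic:
  assumes "lisomorphic L P Q" "is_retract L Q N"
  shows "is_retract L P N"
proof -
  obtain h k where hk: "h \<in> lhom L P Q" "k \<in> lhom L Q P" "\<forall>x \<in> carrier P. k (h x) = x"
    using assms(1) by (auto simp: lisomorphic_def)
  obtain s t where st: "s \<in> lhom L Q N" "t \<in> lhom L N Q" "\<forall>x \<in> carrier Q. t (s x) = x"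
    using assms(2) by (auto simp: is_retract_def is_section_def)
  have "k (t (s (h x))) = x" if "x \<in> carrier P" for x
    using hk(3) st(3) lhom_closed[OF hk(1)] that by simp
  then have "is_section L P N (\<lambda>x. s (h x))"
    unfolding is_section_def using lhom_comp[OF hk(1) st(1)] lhom_comp[OF st(2) hk(2)]
    by (intro conjI bexI[of _ "\<lambda>x. k (t x)"]) auto
  then show ?thesis by (auto simp: is_retract_def)
qed

lemma profinite_retract_of_ultraproduct:
  fixes P :: "('p, 'c, 'f, 'r) lstruct"
  assumes "profinite TYPE('i) TYPE('b) L P"
  shows "\<exists>(I :: 'i set) (N :: 'i \<Rightarrow> ('b, 'c, 'f, 'r) lstruct) U.
    I \<noteq> {} \<and> (\<forall>i \<in> I. is_structure L (N i) \<and> finite (carrier (N i))) \<and>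
    ultrafilter_in I U \<and> is_retract L P (reduced_product L I N U)"
proof -
  obtain J :: "'i set" and s and M :: "'i \<Rightarrow> ('b, 'c, 'f, 'r) lstruct" and g
    and Q :: "('i \<Rightarrow> 'b, 'c, 'f, 'r) lstruct" and \<mu>
    where J: "partial_order_on J s" "down_directed_on J s" "is_diagram L J s M g"
      "\<forall>i \<in> J. finite (carrier (M i))" "is_limit L J s M g Q \<mu>" "lisomorphic L P Q"
    using assms unfolding profinite_def by blast
  \<comment> \<open>Reversing the downward directed order \<open>s\<close> gives the upward directed
    index poset. The locale reverses it again, so the diagram over \<open>s\<close> fits
    unchanged.\<close>
  have po: "partial_order_on J (s\<inverse>)" using J(1) by simp
  obtain U where U: "directed_ultrafilter J (s\<inverse>) U"
    using directed_ultrafilter_exists[OF po J(2)] .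
  interpret finite_diagram_ultrafilter L J "s\<inverse>" M g U
    by unfold_locales (use po J(3,4) U in simp_all)
  have "is_retract L Q (reduced_product L J M U)"
    using limit_section[of Q \<mu>] J(5) by (auto simp: is_retract_def)
  then have "is_retract L P (reduced_product L J M U)" by (rule is_retract_lisomorphic[OF J(6)])
  moreover have "J \<noteq> {}" using J(2) by (simp add: directed_on_def)
  moreover have "ultrafilter_in J U" using U by (simp add: directed_ultrafilter_def)
  ultimately show ?thesis using J(4) component_structure by blast
qed

theorem theorem18:
  fixes L :: "('c, 'f, 'r) language"
  assumes "is_language L"
  shows
    "(\<forall>P :: ('p, 'c, 'f, 'r) lstruct.
        profinite TYPE('i) TYPE('b) L P \<longrightarrow>
        (\<exists>(I :: 'i set) (N :: 'i \<Rightarrow> ('b, 'c, 'f, 'r) lstruct) U.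
           I \<noteq> {} \<and> (\<forall>i \<in> I. is_structure L (N i) \<and> finite (carrier (N i))) \<and>
           ultrafilter_in I U \<and> is_retract L P (reduced_product L I N U)))
     \<and>
     (\<forall>(I :: 'i set) r (M :: 'i \<Rightarrow> ('b, 'c, 'f, 'r) lstruct) f
        (P :: ('p, 'c, 'f, 'r) lstruct) lam U.
        partial_order_on I r \<longrightarrow> directed_on I r \<longrightarrow>
        is_diagram L I (r\<inverse>) M f \<longrightarrow> (\<forall>i \<in> I. finite (carrier (M i))) \<longrightarrow>
        is_limit L I (r\<inverse>) M f P lam \<longrightarrow>
        directed_ultrafilter I r U \<longrightarrow>
        (let \<iota> = (\<lambda>x. \<lambda>i \<in> I. lam i x); \<nu> = quot_map I M U in
           is_section L P (reduced_product L I M U) (\<nu> \<circ> \<iota>)))"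
proof (intro conjI allI impI)
  show "\<exists>(I :: 'i set) (N :: 'i \<Rightarrow> ('b, 'c, 'f, 'r) lstruct) U.
      I \<noteq> {} \<and> (\<forall>i \<in> I. is_structure L (N i) \<and> finite (carrier (N i))) \<and>
      ultrafilter_in I U \<and> is_retract L P (reduced_product L I N U)"
    if "profinite TYPE('i) TYPE('b) L P" for P :: "('p, 'c, 'f, 'r) lstruct"
    using that by (rule profinite_retract_of_ultraproduct)
next
  fix I :: "'i set" and r and M :: "'i \<Rightarrow> ('b, 'c, 'f, 'r) lstruct" and f
    and P :: "('p, 'c, 'f, 'r) lstruct" and lam U
  assume "partial_order_on I r" "is_diagram L I (r\<inverse>) M f" "\<forall>i \<in> I. finite (carrier (M i))"
    "directed_ultrafilter I r U" and lim: "is_limit L I (r\<inverse>) M f P lam"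
  then interpret finite_diagram_ultrafilter L I r M f U by unfold_locales simp_all
  show "let \<iota> = (\<lambda>x. \<lambda>i \<in> I. lam i x); \<nu> = quot_map I M U in
      is_section L P (reduced_product L I M U) (\<nu> \<circ> \<iota>)"
    using limit_section[OF lim] by (simp only: Let_def)
qed

end
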